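(* Let the following objects be given. (G1) A tower $T=\langle T_\alpha:\alpha\in\omega_1\rangle$ in $\mathcal P(\omega)$ with $T_0=\emptyset$ which is strictly increasing, i.e. for all $\beta<\alpha<\omega_1$ the set $T_\beta\setminus T_\alpha$ is finite and $T_\alpha\setminus T_\beta$ is infinite. (G2) A ladder system $\langle\varphi_\lambda:\lambda\in\Lambda\rangle$ on $\Lambda$. (G3) A collection $\langle S(\xi,\eta):\eta<\xi<\omega_1\rangle$ of pairwise disjoint stationary subsets of $\Lambda$ such that each $\lambda\in\Lambda$ is in some $S(\xi,\eta)$, and such that $\lambda\in S(\xi,\eta)$ implies $\eta<\xi<\lambda$. Then there is a collection $\langle A(\xi,\alpha):\xi<\alpha<\omega_1\rangle$ of subsets of $\omega$ satisfying: (1) For every $\xi\in\omega_1$, $\langle A(\xi,\alpha):\xi<\alpha<\omega_1\rangle$ is a subtower of $T$. (2) For every $\alpha\in\omega_1$, $T_\alpha=\bigcup\{A(\xi,\alpha):\xi<\alpha\}$, and this union is disjoint. (3) For all $\eta<\xi<\omega_1$, all $\lambda\in S(\xi,\eta)$ and all $\beta\in\varphi_\lambda$ with $\beta>\eta$, $A(\xi,\lambda)\cap A(\eta,\beta)\neq\emptyset$. (4) For all $\beta<\alpha<\omega_1$ the set $\{\xi: A(\xi,\beta)\not\subseteq A(\xi,\alpha)\}$ is finite.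
   Context: $\Lambda$ is the set of all countable (nonzero) limit ordinals. A ladder system $\langle\varphi_\lambda:\lambda\in\Lambda\rangle$ assigns to each $\lambda\in\Lambda$ an increasing $\omega$-sequence $\varphi_\lambda$ cofinal in $\lambda$; $\varphi_\lambda$ is also identified with its range. For $X,Y\subseteq\omega$, $X\subseteq^*Y$ means $X\setminus Y$ is finite. A tower is a sequence of subsets of $\omega$ that is $\subseteq^*$-increasing in its ordinal index. A subtower $S$ of $T$ is a tower with $S_\alpha\subseteq T_\alpha$ for each index $\alpha$ and such that $S_\alpha\cap(T_\beta\setminus S_\beta)$ is finite for all indices $\beta<\alpha$; in (1), where indices start above $\xi$, these conditions are required for indices in $(\xi,\omega_1)$. By convention $A(\xi,\alpha)=\emptyset$ when $\xi\geq\alpha$. *)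

theory Defs
  imports Main "HOL-Library.Countable_Set_Type" "HOL-Library.Disjoint_Sets"
begin

unbundle cardinal_syntax

text \<open>The ordinal \<open>\<omega>\<^sub>1\<close>, with its elements (the countable ordinals) forming a type: the underlying
  set of the successor cardinal of \<open>\<aleph>\<^sub>0\<close>, ordered by that cardinal. Up to isomorphism it is the
  only uncountable well-order all of whose proper initial segments are countable; these two facts
  are proved below.\<close>

typedef omega1 = "Field (cardSuc natLeq)"
  using Field_cardSuc_not_empty[OF natLeq_Card_order] by auto

instantiation omega1 :: wellorder
begin

definition less_eq_omega1 :: "omega1 \<Rightarrow> omega1 \<Rightarrow> bool" where
  "a \<le> b \<longleftrightarrow> (Rep_omega1 a, Rep_omega1 b) \<in> cardSuc natLeq"

definition less_omega1 :: "omega1 \<Rightarrow> omega1 \<Rightarrow> bool" where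
  "a < b \<longleftrightarrow> a \<le> b \<and> a \<noteq> b" for a b :: omega1

instance
proof -
  let ?r = "cardSuc natLeq"
  have wo: "Well_order ?r"
    by (rule card_order_on_well_order_on[OF cardSuc_Card_order[OF natLeq_Card_order]])
  have rfl: "(Rep_omega1 a, Rep_omega1 a) \<in> ?r" for a
    using wo Rep_omega1[of a] unfolding order_on_defs refl_on_def by blast
  have tr: "(x, z) \<in> ?r" if "(x, y) \<in> ?r" "(y, z) \<in> ?r" for x y z
    using wo that unfolding order_on_defs trans_def by blast
  have as: "x = y" if "(x, y) \<in> ?r" "(y, x) \<in> ?r" for x y
    using wo that unfolding order_on_defs antisym_def by blast
  have tot: "(Rep_omega1 a, Rep_omega1 b) \<in> ?r \<or> (Rep_omega1 b, Rep_omega1 a) \<in> ?r" for a b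
    using wo Rep_omega1[of a] Rep_omega1[of b] rfl[of a]
    unfolding order_on_defs total_on_def by metis
  have wfr: "wf (?r - Id)"
    using wo unfolding well_order_on_def by blast
  show "OFCLASS(omega1, wellorder_class)"
  proof
    fix x y z :: omega1
    show "(x < y) = (x \<le> y \<and> \<not> y \<le> x)"
      unfolding less_omega1_def less_eq_omega1_def using as rfl Rep_omega1_inject by metis
    show "x \<le> x" unfolding less_eq_omega1_def by (rule rfl)
    show "x \<le> y \<Longrightarrow> y \<le> z \<Longrightarrow> x \<le> z" unfolding less_eq_omega1_def by (rule tr)
    show "x \<le> y \<Longrightarrow> y \<le> x \<Longrightarrow> x = y"
      unfolding less_eq_omega1_def using as Rep_omega1_inject by metis
    show "x \<le> y \<or> y \<le> x" unfolding less_eq_omega1_def by (rule tot)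
  next
    fix P :: "omega1 \<Rightarrow> bool" and a :: omega1
    assume step: "\<And>x. (\<And>y. y < x \<Longrightarrow> P y) \<Longrightarrow> P x"
    have "wf (inv_image (?r - Id) Rep_omega1)"
      by (rule wf_inv_image[OF wfr])
    moreover have "inv_image (?r - Id) Rep_omega1 = {(x, y). x < y}"
      by (auto simp: inv_image_def less_omega1_def less_eq_omega1_def Rep_omega1_inject)
    ultimately have "wf {(x, y :: omega1). x < y}" by simp
    then show "P a"
      by (rule wf_induct_rule) (use step in blast)
  qed
qed

end

instantiation omega1 :: zero
begin

definition zero_omega1 :: omega1 where
  "0 = (LEAST a :: omega1. True)"

instance ..

end

lemma omega1_zero_le: "0 \<le> a" for a :: omega1
  unfolding zero_omega1_def by (simp add: Least_le)

lemma omega1_uncountable: "uncountable (UNIV :: omega1 set)"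
proof
  assume "countable (UNIV :: omega1 set)"
  then have "countable (range Rep_omega1)" by blast
  then have "countable (Field (cardSuc natLeq))"
    by (simp add: type_definition.Rep_range[OF type_definition_omega1])
  then have "|Field (cardSuc natLeq)| \<le>o natLeq"
    by (simp add: countable_card_le_natLeq)
  then have "cardSuc natLeq \<le>o natLeq"
    using card_of_Field_ordIso[OF cardSuc_Card_order[OF natLeq_Card_order]]
      ordIso_ordLeq_trans ordIso_symmetric by blast
  then show False
    using cardSuc_greater[OF natLeq_Card_order] not_ordLess_ordLeq by blast
qed

lemma omega1_countable_lessThan: "countable {..<a}" for a :: omega1
proof -
  let ?u = "underS (cardSuc natLeq) (Rep_omega1 a)"
  have "|?u| <o cardSuc natLeq"
    by (rule card_of_underS[OF cardSuc_Card_order[OF natLeq_Card_order] Rep_omega1])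
  then have "|?u| \<le>o natLeq"
    using cardSuc_ordLess_ordLeq[OF natLeq_Card_order card_of_Card_order]
      card_of_Well_order natLeq_Well_order not_ordLeq_iff_ordLess not_ordLess_ordLeq by metis
  then have "countable ?u" by (simp add: countable_card_le_natLeq)
  moreover have "Rep_omega1 ` {..<a} \<subseteq> ?u"
    by (auto simp: underS_def less_omega1_def less_eq_omega1_def Rep_omega1_inject)
  ultimately have "countable (Rep_omega1 ` {..<a})" by (rule countable_subset[rotated])
  then show ?thesis
    by (rule countable_image_inj_on) (auto simp: inj_on_def Rep_omega1_inject)
qed

definition Lim :: "omega1 set" where
  "Lim = {l. l \<noteq> 0 \<and> (\<forall>b<l. \<exists>c. b < c \<and> c < l)}"

definition closed_unbounded :: "omega1 set \<Rightarrow> bool" where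
  "closed_unbounded C \<longleftrightarrow>
     (\<forall>a. \<exists>c\<in>C. a < c) \<and>
     (\<forall>l\<in>Lim. (\<forall>b<l. \<exists>c\<in>C. b < c \<and> c < l) \<longrightarrow> l \<in> C)"

definition stationary :: "omega1 set \<Rightarrow> bool" where
  "stationary S \<longleftrightarrow> (\<forall>C. closed_unbounded C \<longrightarrow> S \<inter> C \<noteq> {})"

definition ladder_system :: "(omega1 \<Rightarrow> nat \<Rightarrow> omega1) \<Rightarrow> bool" where
  "ladder_system \<phi> \<longleftrightarrow>
     (\<forall>l\<in>Lim. strict_mono (\<phi> l) \<and> (\<forall>n. \<phi> l n < l) \<and> (\<forall>b<l. \<exists>n. b < \<phi> l n))"

definition almost_subset :: "nat set \<Rightarrow> nat set \<Rightarrow> bool"  (infix \<open>\<subseteq>\<^sup>*\<close> 50) where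
  "X \<subseteq>\<^sup>* Y \<longleftrightarrow> finite (X - Y)"

text \<open>Towers are indexed by a set \<open>I\<close> of ordinals; values outside \<open>I\<close> are irrelevant.\<close>

definition tower_on :: "omega1 set \<Rightarrow> (omega1 \<Rightarrow> nat set) \<Rightarrow> bool" where
  "tower_on I T \<longleftrightarrow> (\<forall>a\<in>I. \<forall>b\<in>I. b < a \<longrightarrow> T b \<subseteq>\<^sup>* T a)"

definition strict_tower :: "(omega1 \<Rightarrow> nat set) \<Rightarrow> bool" where
  "strict_tower T \<longleftrightarrow> tower_on UNIV T \<and> (\<forall>a b. b < a \<longrightarrow> infinite (T a - T b))"

definition subtower_on :: "omega1 set \<Rightarrow> (omega1 \<Rightarrow> nat set) \<Rightarrow> (omega1 \<Rightarrow> nat set) \<Rightarrow> bool" where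
  "subtower_on I S T \<longleftrightarrow>
     tower_on I S \<and>
     (\<forall>a\<in>I. S a \<subseteq> T a) \<and>
     (\<forall>a\<in>I. \<forall>b\<in>I. b < a \<longrightarrow> finite (S a \<inter> (T b - S b)))"

end

theory Submission
  imports Defs
begin

text \<open>
  A disjoint decomposition \<open>T\<^sub>\<alpha> = \<Union>\<^sub>\<xi>\<^sub><\<^sub>\<alpha> A(\<xi>, \<alpha>)\<close> is the same thing as a colouring
  \<open>f\<^sub>\<alpha> : T\<^sub>\<alpha> \<rightarrow> \<alpha>\<close>, with \<open>A(\<xi>, \<alpha>)\<close> the set of points of colour \<open>\<xi>\<close>. For \<open>\<beta> < \<alpha>\<close>, the
  subtower conditions together with the finiteness of \<open>{\<xi>. A(\<xi>, \<beta>) \<not>\<subseteq> A(\<xi>, \<alpha>)}\<close> say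
  precisely that \<open>f\<^sub>\<beta>\<close> and \<open>f\<^sub>\<alpha>\<close> agree at all but finitely many points of \<open>T\<^sub>\<beta>\<close>. So what is
  needed is a coherent sequence of colourings that at each \<open>\<lambda> \<in> S(\<xi>, \<eta>)\<close> has, for every rung
  \<open>\<beta> > \<eta>\<close> of the ladder at \<open>\<lambda>\<close>, a point with \<open>f\<^sub>\<beta>\<close>-colour \<open>\<eta>\<close> and \<open>f\<^sub>\<lambda>\<close>-colour \<open>\<xi>\<close>.

  The colourings are built by recursion on \<open>\<alpha>\<close>, keeping every colour \<open>\<eta> < \<alpha>\<close> infinite on
  \<open>T\<^sub>\<alpha> - T\<^sub>\<gamma>\<close> for all \<open>\<gamma> < \<alpha>\<close>. At a successor \<open>\<beta> + 1\<close> the infinite set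
  \<open>T\<^sub>\<beta>\<^sub>+\<^sub>1 - T\<^sub>\<beta>\<close> is split into infinitely many points of each of the countably many colours
  (\<open>colouring_successor\<close>). At a limit \<open>\<lambda>\<close> with ladder \<open>\<beta>\<^sub>0 < \<beta>\<^sub>1 < \<dots>\<close>, a point gets the colour
  that it has at the first rung whose set contains it, and then one point \<open>p\<^sub>k\<close> with
  \<open>f\<^sub>\<beta>\<^sub>k(p\<^sub>k) = \<eta>\<close> is recoloured \<open>\<xi>\<close> for each \<open>k\<close>
  with \<open>\<eta> < \<beta>\<^sub>k\<close>. Coherence survives because \<open>p\<^sub>k\<close> is
  taken outside all earlier sets \<open>T\<^sub>\<beta>\<^sub>j\<close>, so that each of these sets loses only finitely many
  points; the recursion hypothesis is what makes such a \<open>p\<^sub>k\<close> available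
  (\<open>glue_with_recolouring\<close>, \<open>colouring_limit\<close>).
\<close>

section \<open>Colourings of countable sets\<close>

lemma exists_colouring_with_infinite_fibres:
  assumes "countable R" "infinite R" "countable C" "C \<noteq> {}"
  shows "\<exists>h. range h \<subseteq> C \<and> (\<forall>c\<in>C. infinite {n\<in>R. h n = c})"
proof -
  define e where "e = to_nat_on R"
  have e: "bij_betw e R UNIV"
    unfolding e_def using assms(1,2) by (rule to_nat_on_infinite)
  \<comment> \<open>Number the points of \<open>R\<close> by pairs and let the first coordinate name the colour.\<close>
  define h where "h = (\<lambda>n. from_nat_into C (fst (prod_decode (e n))))"
  have "infinite {n\<in>R. h n = c}" if c: "c \<in> C" for c
  proof -
    obtain i where i: "from_nat_into C i = c"
      using from_nat_into_surj[OF assms(3) c] by blast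
    let ?q = "\<lambda>j. inv_into R e (prod_encode (i, j))"
    have eq: "?q j \<in> R \<and> e (?q j) = prod_encode (i, j)" for j
      using e by (metis UNIV_I bij_betw_def f_inv_into_f inv_into_into)
    have "inj ?q"
      by (rule injI) (metis eq prod.inject prod_encode_eq)
    then have "infinite (range ?q)"
      by (simp add: finite_image_iff)
    moreover have "range ?q \<subseteq> {n\<in>R. h n = c}"
      using eq i by (auto simp: h_def)
    ultimately show ?thesis
      using finite_subset by blast
  qed
  moreover have "range h \<subseteq> C"
    using from_nat_into[OF assms(4)] by (auto simp: h_def)
  ultimately show ?thesis by blast
qed

text \<open>The colour of a point is read off at the first index whose domain contains it; on
  \<open>D j\<close> only the finitely many indices up to \<open>j\<close> are then consulted, which gives agreement with
  \<open>g j\<close> up to a finite set. The points \<open>p k\<close> may be overridden for the same reason: only those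
  with \<open>k \<le> j\<close> can lie in \<open>D j\<close>.\<close>

lemma glue_with_recolouring:
  fixes D :: "nat \<Rightarrow> 'a set" and g :: "nat \<Rightarrow> 'a \<Rightarrow> 'b"
  assumes coherent: "\<And>j k. j < k \<Longrightarrow> finite {n \<in> D j \<inter> D k. g j n \<noteq> g k n}"
    and late: "\<And>j k. k \<in> K \<Longrightarrow> j < k \<Longrightarrow> p k \<notin> D j"
  obtains f where "\<And>k. k \<in> K \<Longrightarrow> f (p k) = c"
    and "\<And>j. finite {n \<in> D j. f n \<noteq> g j n}"
    and "\<And>n. f n = c \<or> (\<exists>k. n \<in> D k \<and> f n = g k n)"
proof -
  define first where "first n = (LEAST k. n \<in> D k)" for n
  define f where "f n = (if n \<in> p ` K \<or> (\<forall>k. n \<notin> D k) then c else g (first n) n)" for n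
  have first: "n \<in> D (first n) \<and> first n \<le> j" if "n \<in> D j" for n j
    unfolding first_def using that by (metis LeastI Least_le)
  have "finite {n \<in> D j. f n \<noteq> g j n}" for j
  proof -
    have "{n \<in> D j. f n \<noteq> g j n} \<subseteq> p ` {..j} \<union> (\<Union>k<j. {n \<in> D k \<inter> D j. g k n \<noteq> g j n})"
    proof
      fix n assume n: "n \<in> {n \<in> D j. f n \<noteq> g j n}"
      show "n \<in> p ` {..j} \<union> (\<Union>k<j. {n \<in> D k \<inter> D j. g k n \<noteq> g j n})"
      proof (cases "n \<in> p ` K")
        case True
        then show ?thesis using n late by (force intro: leI)
      next
        case False
        then have "f n = g (first n) n" using n by (auto simp: f_def)
        moreover have "first n \<noteq> j" using calculation n by auto
        moreover from this have "first n < j" using n first[of n j] by simp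
        ultimately show ?thesis using n first[of n j] by auto
      qed
    qed
    then show ?thesis
      by (rule finite_subset) (use coherent in auto)
  qed
  moreover have "f n = c \<or> (\<exists>k. n \<in> D k \<and> f n = g k n)" for n
  proof (cases "n \<in> p ` K \<or> (\<forall>k. n \<notin> D k)")
    case True
    then show ?thesis by (simp add: f_def)
  next
    case False
    then have "n \<in> D (first n)" using first by blast
    moreover have "f n = g (first n) n" unfolding f_def by (rule if_not_P[OF False])
    ultimately show ?thesis by blast
  qed
  ultimately show ?thesis
    by (intro that[of f]) (auto simp: f_def)
qed

section \<open>Extending a coherent sequence of colourings by one step\<close>

text \<open>The recursion hypothesis: \<open>g\<close> is a possible value at \<open>\<alpha>\<close> of a coherent sequence of
  colourings whose values below \<open>\<alpha>\<close> are given by \<open>f\<close>. The last clause supplies fresh points of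
  every colour for the recolouring at later limits.\<close>

definition coherent_colouring ::
    "(omega1 \<Rightarrow> nat set) \<Rightarrow> (omega1 \<Rightarrow> nat \<Rightarrow> omega1) \<Rightarrow> omega1 \<Rightarrow> (nat \<Rightarrow> omega1) \<Rightarrow> bool" where
  "coherent_colouring T f \<alpha> g \<longleftrightarrow>
     (\<forall>n\<in>T \<alpha>. g n < \<alpha>) \<and>
     (\<forall>\<beta><\<alpha>. finite {n \<in> T \<beta> \<inter> T \<alpha>. f \<beta> n \<noteq> g n}) \<and>
     (\<forall>\<eta><\<alpha>. \<forall>\<gamma><\<alpha>. infinite {n \<in> T \<alpha> - T \<gamma>. g n = \<eta>})"

lemma strict_tower_finite_diff: "strict_tower T \<Longrightarrow> \<beta> \<le> \<alpha> \<Longrightarrow> finite (T \<beta> - T \<alpha>)"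
  by (cases "\<beta> = \<alpha>") (auto simp: strict_tower_def tower_on_def almost_subset_def)

lemma colouring_successor:
  assumes T: "strict_tower T"
    and prev: "\<And>\<beta>. \<beta> < \<alpha> \<Longrightarrow> coherent_colouring T f \<beta> (f \<beta>)"
    and pred: "\<delta> < \<alpha>" "\<And>\<beta>. \<beta> < \<alpha> \<Longrightarrow> \<beta> \<le> \<delta>"
  shows "\<exists>g. coherent_colouring T f \<alpha> g"
proof -
  have inf: "infinite (T \<alpha> - T \<delta>)"
    using T pred(1) by (auto simp: strict_tower_def)
  obtain h where h: "range h \<subseteq> {..<\<alpha>}"
      and h_inf: "\<And>c. c < \<alpha> \<Longrightarrow> infinite {n \<in> T \<alpha> - T \<delta>. h n = c}"
    using exists_colouring_with_infinite_fibres[OF _ inf omega1_countable_lessThan[of \<alpha>]] pred(1)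
    by (metis countableI_type emptyE lessThan_iff)
  define g where "g n = (if n \<in> T \<delta> then f \<delta> n else h n)" for n
  have "g n < \<alpha>" if "n \<in> T \<alpha>" for n
    using h prev[OF pred(1)] pred(1)
    by (auto simp: g_def coherent_colouring_def intro: less_trans)
  moreover have "finite {n \<in> T \<beta> \<inter> T \<alpha>. f \<beta> n \<noteq> g n}" if "\<beta> < \<alpha>" for \<beta>
  proof (cases "\<beta> = \<delta>")
    case True
    then show ?thesis by (simp add: g_def)
  next
    case False
    then have \<beta>: "\<beta> < \<delta>" using pred(2)[OF that] by simp
    have "{n \<in> T \<beta> \<inter> T \<alpha>. f \<beta> n \<noteq> g n}
        \<subseteq> (T \<beta> - T \<delta>) \<union> {n \<in> T \<beta> \<inter> T \<delta>. f \<beta> n \<noteq> f \<delta> n}"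
      by (auto simp: g_def)
    then show ?thesis
      by (rule finite_subset)
        (use prev[OF pred(1)] \<beta> strict_tower_finite_diff[OF T] in
          \<open>auto simp: coherent_colouring_def\<close>)
  qed
  moreover have "infinite {n \<in> T \<alpha> - T \<gamma>. g n = \<eta>}" if "\<eta> < \<alpha>" "\<gamma> < \<alpha>" for \<eta> \<gamma>
  proof -
    have "{n \<in> T \<alpha> - T \<delta>. h n = \<eta>} \<subseteq> {n \<in> T \<alpha> - T \<gamma>. g n = \<eta>} \<union> (T \<gamma> - T \<delta>)"
      by (auto simp: g_def)
    moreover have "finite (T \<gamma> - T \<delta>)"
      using strict_tower_finite_diff[OF T pred(2)[OF that(2)]] .
    ultimately show ?thesis
      using h_inf[OF that(1)] by (meson finite_Un finite_subset)
  qed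
  ultimately show ?thesis
    unfolding coherent_colouring_def by blast
qed

text \<open>Along a ladder, the recursion hypothesis provides at each rung \<open>b k > \<eta>\<close> infinitely many
  points of colour \<open>\<eta>\<close> outside the previous rung, hence one that lies in \<open>T \<mu>\<close> and outside all
  previous rungs; it is recoloured \<open>\<xi>\<close>. The recursion hypothesis at \<open>\<mu>\<close> is inherited from a rung
  above the given colour and index.\<close>

lemma colouring_limit:
  fixes b :: "nat \<Rightarrow> omega1"
  assumes T: "strict_tower T"
    and prev: "\<And>\<beta>. \<beta> < \<mu> \<Longrightarrow> coherent_colouring T f \<beta> (f \<beta>)"
    and b: "strict_mono b" "\<And>n. b n < \<mu>" "\<And>\<beta>. \<beta> < \<mu> \<Longrightarrow> \<exists>n. \<beta> < b n"
    and \<xi>: "\<xi> < \<mu>"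
  shows "\<exists>g. coherent_colouring T f \<mu> g \<and>
           (\<forall>k. \<eta> < b k \<longrightarrow> (\<exists>n \<in> T (b k) \<inter> T \<mu>. g n = \<xi> \<and> f (b k) n = \<eta>))"
proof -
  define K where "K = {k. \<eta> < b k}"
  have mono: "b j < b k" if "j < k" for j k
    using b(1) that by (simp add: strict_mono_def)
  have coh: "finite {n \<in> T \<beta> \<inter> T (b k). f \<beta> n \<noteq> f (b k) n}" if "\<beta> < b k" for \<beta> k
    using prev[OF b(2)] that by (auto simp: coherent_colouring_def)
  have inf: "infinite {n \<in> T (b k) - T \<gamma>. f (b k) n = \<eta>}" if "\<eta> < b k" "\<gamma> < b k" for \<eta> \<gamma> k
    using prev[OF b(2)] that by (auto simp: coherent_colouring_def)
  have fin_lim: "finite (T (b k) - T \<mu>)" for k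
    using strict_tower_finite_diff[OF T] b(2) by (simp add: less_imp_le)

  have "\<exists>x. x \<in> T (b k) \<inter> T \<mu> \<and> f (b k) x = \<eta> \<and> (\<forall>j<k. x \<notin> T (b j))" if "k \<in> K" for k
  proof -
    have \<eta>: "\<eta> < b k" using that by (simp add: K_def)
    \<comment> \<open>Up to finitely many points, the set of the last rung before \<open>b k\<close> covers those of all
      earlier rungs. For \<open>k = 0\<close> there is nothing to avoid, and any index below \<open>b 0\<close> will do.\<close>
    define \<gamma> where "\<gamma> = (if k = 0 then 0 else b (k - 1))"
    have "\<gamma> < b k"
      using \<eta> mono omega1_zero_le[of \<eta>] by (auto simp: \<gamma>_def)
    from inf[OF \<eta> this] have i: "infinite {n \<in> T (b k) - T \<gamma>. f (b k) n = \<eta>}" .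
    have "b j \<le> \<gamma>" if "j < k" for j
      using that strict_mono_less_eq[OF b(1), of j "k - 1"] by (auto simp: \<gamma>_def)
    then have "finite ((\<Union>j<k. T (b j) - T \<gamma>) \<union> (T (b k) - T \<mu>))"
      using strict_tower_finite_diff[OF T] fin_lim by (intro finite_UnI finite_UN_I) auto
    from Diff_infinite_finite[OF this i] obtain x
      where "x \<in> {n \<in> T (b k) - T \<gamma>. f (b k) n = \<eta>} - ((\<Union>j<k. T (b j) - T \<gamma>) \<union> (T (b k) - T \<mu>))"
      using infinite_imp_nonempty by blast
    then show ?thesis by (intro exI[of _ x]) auto
  qed
  then obtain p where p: "\<And>k. k \<in> K \<Longrightarrow> p k \<in> T (b k) \<inter> T \<mu> \<and> f (b k) (p k) = \<eta>"
      and p_late: "\<And>k j. k \<in> K \<Longrightarrow> j < k \<Longrightarrow> p k \<notin> T (b j)"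
    by metis

  obtain g where g_p: "\<And>k. k \<in> K \<Longrightarrow> g (p k) = \<xi>"
      and g_fin: "\<And>j. finite {n \<in> T (b j). g n \<noteq> f (b j) n}"
      and g_val: "\<And>n. g n = \<xi> \<or> (\<exists>k. n \<in> T (b k) \<and> g n = f (b k) n)"
    using glue_with_recolouring[of "\<lambda>k. T (b k)" "\<lambda>k. f (b k)" K p \<xi>] coh mono p_late by blast

  have "f (b k) n < b k" if "n \<in> T (b k)" for k n
    using prev[OF b(2)] that by (auto simp: coherent_colouring_def)
  then have "g n < \<mu>" for n
    using g_val[of n] \<xi> b(2) by (metis less_trans)
  moreover have "finite {n \<in> T \<beta> \<inter> T \<mu>. f \<beta> n \<noteq> g n}" if "\<beta> < \<mu>" for \<beta>
  proof -
    obtain k where k: "\<beta> < b k" using b(3) \<open>\<beta> < \<mu>\<close> by blast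
    have "{n \<in> T \<beta> \<inter> T \<mu>. f \<beta> n \<noteq> g n} \<subseteq> (T \<beta> - T (b k)) \<union>
        {n \<in> T \<beta> \<inter> T (b k). f \<beta> n \<noteq> f (b k) n} \<union> {n \<in> T (b k). g n \<noteq> f (b k) n}"
      by auto
    then show ?thesis
      by (rule finite_subset)
        (use coh[OF k] g_fin strict_tower_finite_diff[OF T less_imp_le[OF k]] in auto)
  qed
  moreover have "infinite {n \<in> T \<mu> - T \<gamma>. g n = \<eta>'}" if "\<eta>' < \<mu>" "\<gamma> < \<mu>" for \<eta>' \<gamma>
  proof -
    obtain k where k: "\<eta>' < b k" "\<gamma> < b k"
      using b(3)[of "max \<eta>' \<gamma>"] \<open>\<eta>' < \<mu>\<close> \<open>\<gamma> < \<mu>\<close> by auto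
    have "{n \<in> T (b k) - T \<gamma>. f (b k) n = \<eta>'} \<subseteq> {n \<in> T \<mu> - T \<gamma>. g n = \<eta>'} \<union>
        (T (b k) - T \<mu>) \<union> {n \<in> T (b k). g n \<noteq> f (b k) n}"
      by auto
    then show ?thesis
      using inf[OF k] fin_lim[of k] g_fin[of k] by (meson finite_Un finite_subset)
  qed
  moreover have "\<exists>n \<in> T (b k) \<inter> T \<mu>. g n = \<xi> \<and> f (b k) n = \<eta>" if "\<eta> < b k" for k
    using p[of k] g_p[of k] that by (auto simp: K_def)
  ultimately show ?thesis
    unfolding coherent_colouring_def by blast
qed

section \<open>The coherent sequence and the decomposition\<close>

theorem theorem41:
  fixes T :: "omega1 \<Rightarrow> nat set"
    and \<phi> :: "omega1 \<Rightarrow> nat \<Rightarrow> omega1"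
    and S :: "omega1 \<Rightarrow> omega1 \<Rightarrow> omega1 set"
  assumes T: "strict_tower T" "T 0 = {}"
    and \<phi>: "ladder_system \<phi>"
    and S_stationary: "\<And>\<xi> \<eta>. \<eta> < \<xi> \<Longrightarrow> S \<xi> \<eta> \<subseteq> Lim \<and> stationary (S \<xi> \<eta>)"
    and S_disjoint: "disjoint_family_on (\<lambda>(\<xi>, \<eta>). S \<xi> \<eta>) {(\<xi>, \<eta>). \<eta> < \<xi>}"
    and S_cover: "\<And>l. l \<in> Lim \<Longrightarrow> \<exists>\<xi> \<eta>. \<eta> < \<xi> \<and> l \<in> S \<xi> \<eta>"
    and S_bound: "\<And>\<xi> \<eta> l. \<eta> < \<xi> \<Longrightarrow> l \<in> S \<xi> \<eta> \<Longrightarrow> \<xi> < l"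
  shows "\<exists>A :: omega1 \<Rightarrow> omega1 \<Rightarrow> nat set.
           (\<forall>\<xi> \<alpha>. \<alpha> \<le> \<xi> \<longrightarrow> A \<xi> \<alpha> = {}) \<and>
           (\<forall>\<xi>. subtower_on {\<xi><..} (A \<xi>) T) \<and>
           (\<forall>\<alpha>. T \<alpha> = (\<Union>\<xi>\<in>{..<\<alpha>}. A \<xi> \<alpha>) \<and> disjoint_family_on (\<lambda>\<xi>. A \<xi> \<alpha>) {..<\<alpha>}) \<and>
           (\<forall>\<xi> \<eta>. \<eta> < \<xi> \<longrightarrow> (\<forall>l\<in>S \<xi> \<eta>. \<forall>\<beta>\<in>range (\<phi> l). \<eta> < \<beta> \<longrightarrow> A \<xi> l \<inter> A \<eta> \<beta> \<noteq> {})) \<and>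
           (\<forall>\<alpha> \<beta>. \<beta> < \<alpha> \<longrightarrow> finite {\<xi>. \<not> A \<xi> \<beta> \<subseteq> A \<xi> \<alpha>})"
proof -
  define meets where "meets f \<alpha> g \<longleftrightarrow>
      (\<forall>\<xi> \<eta>. \<eta> < \<xi> \<longrightarrow> \<alpha> \<in> S \<xi> \<eta> \<longrightarrow> (\<forall>k. \<eta> < \<phi> \<alpha> k \<longrightarrow>
        (\<exists>n \<in> T (\<phi> \<alpha> k) \<inter> T \<alpha>. g n = \<xi> \<and> f (\<phi> \<alpha> k) n = \<eta>)))"
    for f :: "omega1 \<Rightarrow> nat \<Rightarrow> omega1" and \<alpha> g
  have lad: "strict_mono (\<phi> l)" "\<phi> l n < l" "b < l \<Longrightarrow> \<exists>n. b < \<phi> l n" if "l \<in> Lim" for l b n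
    using \<phi> that by (auto simp: ladder_system_def)
  have in_Lim: "\<alpha> \<in> Lim" if "\<eta> < \<xi>" "\<alpha> \<in> S \<xi> \<eta>" for \<alpha> \<xi> \<eta>
    using S_stationary that by blast
  have meets_trivial: "meets f \<alpha> g" if "\<alpha> \<notin> Lim" for f \<alpha> g
    using in_Lim that by (auto simp: meets_def)

  have "\<exists>f. \<forall>\<alpha>. coherent_colouring T f \<alpha> (f \<alpha>) \<and> meets f \<alpha> (f \<alpha>)"
  proof (rule dependent_wellorder_choice)
    fix g :: "nat \<Rightarrow> omega1" and f f' :: "omega1 \<Rightarrow> nat \<Rightarrow> omega1" and \<alpha>
    assume eq: "\<And>\<beta>. \<beta> < \<alpha> \<Longrightarrow> f \<beta> = f' \<beta>"
    have "coherent_colouring T f \<alpha> g = coherent_colouring T f' \<alpha> g"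
      using eq by (simp add: coherent_colouring_def)
    moreover have "meets f \<alpha> g = meets f' \<alpha> g"
      using eq lad(2)[of \<alpha>] meets_trivial by (cases "\<alpha> \<in> Lim") (simp_all add: meets_def)
    ultimately show "(coherent_colouring T f \<alpha> g \<and> meets f \<alpha> g) =
        (coherent_colouring T f' \<alpha> g \<and> meets f' \<alpha> g)" by simp
  next
    fix \<alpha> and f :: "omega1 \<Rightarrow> nat \<Rightarrow> omega1"
    assume "\<And>\<beta>. \<beta> < \<alpha> \<Longrightarrow> coherent_colouring T f \<beta> (f \<beta>) \<and> meets f \<beta> (f \<beta>)"
    then have prev: "\<And>\<beta>. \<beta> < \<alpha> \<Longrightarrow> coherent_colouring T f \<beta> (f \<beta>)" by blast
    consider (zero) "\<alpha> = 0" | (limit) "\<alpha> \<in> Lim"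
      | (successor) \<delta> where "\<alpha> \<noteq> 0" "\<alpha> \<notin> Lim" "\<delta> < \<alpha>" "\<And>\<beta>. \<beta> < \<alpha> \<Longrightarrow> \<beta> \<le> \<delta>"
      unfolding Lim_def mem_Collect_eq by (meson not_le)
    then show "\<exists>g. coherent_colouring T f \<alpha> g \<and> meets f \<alpha> g"
    proof cases
      case zero
      then have "coherent_colouring T f \<alpha> g" for g
        using T(2) leD[OF omega1_zero_le] by (auto simp: coherent_colouring_def)
      moreover have "\<alpha> \<notin> Lim" using zero by (simp add: Lim_def)
      ultimately show ?thesis using meets_trivial by blast
    next
      case successor
      then obtain g where "coherent_colouring T f \<alpha> g"
        using colouring_successor[OF T(1) prev] by metis
      then show ?thesis using meets_trivial[OF successor(2)] by blast
    next
      case limit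
      obtain \<xi> \<eta> where S: "\<eta> < \<xi>" "\<alpha> \<in> S \<xi> \<eta>"
        using S_cover[OF limit] by blast
      obtain g where g: "coherent_colouring T f \<alpha> g"
          "\<And>k. \<eta> < \<phi> \<alpha> k \<Longrightarrow> \<exists>n \<in> T (\<phi> \<alpha> k) \<inter> T \<alpha>. g n = \<xi> \<and> f (\<phi> \<alpha> k) n = \<eta>"
        using colouring_limit[OF T(1) prev lad[OF limit] S_bound[OF S], of \<eta>] by blast
      \<comment> \<open>Disjointness of the \<open>S \<xi> \<eta>\<close> leaves a single requirement at \<open>\<alpha>\<close>.\<close>
      have "\<xi>' = \<xi> \<and> \<eta>' = \<eta>" if "\<eta>' < \<xi>'" "\<alpha> \<in> S \<xi>' \<eta>'" for \<xi>' \<eta>'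
        using disjoint_family_onD[OF S_disjoint, of "(\<xi>', \<eta>')" "(\<xi>, \<eta>)"] that S by auto
      then have "meets f \<alpha> g"
        unfolding meets_def using g(2) by blast
      then show ?thesis using g(1) by blast
    qed
  qed
  then obtain f where "\<And>\<alpha>. coherent_colouring T f \<alpha> (f \<alpha>)" and meets: "\<And>\<alpha>. meets f \<alpha> (f \<alpha>)"
    by blast
  then have f_less: "\<And>\<alpha> n. n \<in> T \<alpha> \<Longrightarrow> f \<alpha> n < \<alpha>"
    and f_coh: "\<And>\<alpha> \<beta>. \<beta> < \<alpha> \<Longrightarrow> finite {n \<in> T \<beta> \<inter> T \<alpha>. f \<beta> n \<noteq> f \<alpha> n}"
    by (auto simp: coherent_colouring_def)

  define A where "A \<xi> \<alpha> = {n \<in> T \<alpha>. f \<alpha> n = \<xi>}" for \<xi> \<alpha>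
  \<comment> \<open>The finitely many points of \<open>T \<beta>\<close> that leave the tower or change colour between \<open>\<beta>\<close> and
    \<open>\<alpha>\<close>; every finiteness claim is about a subset or an image of this set.\<close>
  define bad where "bad \<alpha> \<beta> = (T \<beta> - T \<alpha>) \<union> {n \<in> T \<beta> \<inter> T \<alpha>. f \<beta> n \<noteq> f \<alpha> n}" for \<alpha> \<beta>
  have fin_bad: "finite (bad \<alpha> \<beta>)" if "\<beta> < \<alpha>" for \<alpha> \<beta>
    using f_coh[OF that] strict_tower_finite_diff[OF T(1), of \<beta> \<alpha>] that by (simp add: bad_def)
  have empty: "A \<xi> \<alpha> = {}" if "\<alpha> \<le> \<xi>" for \<xi> \<alpha>
    using that f_less by (fastforce simp: A_def)
  have subtower: "subtower_on {\<xi><..} (A \<xi>) T" for \<xi>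
  proof -
    have "finite (A \<xi> \<beta> - A \<xi> \<alpha>)" "finite (A \<xi> \<alpha> \<inter> (T \<beta> - A \<xi> \<beta>))" if "\<beta> < \<alpha>" for \<alpha> \<beta>
      by (rule finite_subset[OF _ fin_bad[OF that]], auto simp: A_def bad_def)+
    then show ?thesis
      by (auto simp: subtower_on_def tower_on_def almost_subset_def A_def)
  qed
  have partition: "T \<alpha> = (\<Union>\<xi>\<in>{..<\<alpha>}. A \<xi> \<alpha>) \<and> disjoint_family_on (\<lambda>\<xi>. A \<xi> \<alpha>) {..<\<alpha>}" for \<alpha>
    using f_less by (auto simp: A_def disjoint_family_on_def)
  have meet: "A \<xi> l \<inter> A \<eta> \<beta> \<noteq> {}"
    if "\<eta> < \<xi>" "l \<in> S \<xi> \<eta>" "\<beta> \<in> range (\<phi> l)" "\<eta> < \<beta>" for \<xi> \<eta> l \<beta>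
    using meets[of l] that unfolding meets_def A_def by blast
  have almost_inc: "finite {\<xi>. \<not> A \<xi> \<beta> \<subseteq> A \<xi> \<alpha>}" if "\<beta> < \<alpha>" for \<alpha> \<beta>
    by (rule finite_subset[OF _ finite_imageI[OF fin_bad[OF that], of "f \<beta>"]])
      (auto simp: A_def bad_def)
  show ?thesis
    by (intro exI[of _ A] conjI allI impI ballI
        empty subtower partition[THEN conjunct1] partition[THEN conjunct2] meet almost_inc)
qed

end
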